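(* Let $X\in\mathbb{R}^{m\times n}$ be a tall-skinny matrix of full column rank, and let $\hat W$ be the matrix computed by the preconditioning phase of RCLUPPr in floating-point arithmetic with sketch matrix $\Omega$, that is, $\hat L\hat U=PX+\Delta_{lu}$, $\hat L_s=\Omega\hat L+\Delta_s$, $\hat H\hat Y_0=\hat L_s+\Delta_h$, $\hat Y_1=\hat Y_0\hat U+\Delta_y$, $\hat W\hat Y_1=X+\Delta_x$, with the two-precision rounding model, the assumption on $\Omega$ and $\epsilon$, and the size restrictions listed in the context. Then, with probability at least $(1-p)^2$, both $$\|\hat W\|_2\le\frac{1.28}{(1-\epsilon)^{1/2}}\qquad\text{and}\qquad \sigma_n(\hat W)\ge\frac{4}{5(1+\epsilon)^{1/2}}-\frac{0.08}{(1-\epsilon)^{1/2}} .$$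
   Context: Notation: $\|\cdot\|_2$, $\|\cdot\|_F$ are the spectral and Frobenius norms; $\sigma_i(A)$ is the $i$-th largest singular value; $\kappa_2(A)=\|A\|_2/\sigma_n(A)$ for a matrix with $n$ columns; $|A|$ is the entrywise absolute value, and inequalities between matrices are entrywise. Hats denote computed quantities. For a unit roundoff $v$ and positive $k$, $\gamma_k(v)=\frac{kv}{1-kv}$; throughout it is assumed that $\gamma_k(v)\le 1.02kv$ for all $k,v$ occurring. Dimensions: $X\in\mathbb{R}^{m\times n}$ has full column rank, $m>n$, and $\Omega\in\mathbb{R}^{s\times m}$ with $n\le s\le m$. Sketching: $\Omega$ is a random matrix. For $0\le\epsilon<1$, a matrix $\Omega$ is an $\epsilon$-subspace embedding for a subspace $\mathcal K\subset\mathbb{R}^m$ if $|\langle x,y\rangle-\langle\Omega x,\Omega y\rangle|\le\epsilon\|x\|_2\|y\|_2$ for all $x,y\in\mathcal K$. A random $\Omega$ is an $(\epsilon,p,n)$ oblivious $l_2$-subspace embedding if for every fixed $n$-dimensional subspace $\mathcal K\subset\mathbb{R}^m$ it is an $\epsilon$-subspace embedding for $\mathcal K$ with probability at least $1-p$. Computed quantities and rounding model: $\mathbf u$ is the working unit roundoff, and $\mathbf u_b\le\mathbf u$ is the (higher-precision or equal) unit roundoff used for the sketching, Householder QR and $Y_0U$ steps; all other steps use $\mathbf u$. (i) LU factorization with partial pivoting: $\hat L\hat U=PX+\Delta_{lu}$, $P$ a permutation matrix, $\hat L\in\mathbb{R}^{m\times n}$ unit lower trapezoidal, $\hat U\in\mathbb{R}^{n\times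 n}$ upper triangular, $|\Delta_{lu}|\le\gamma_n(\mathbf u)|\hat L||\hat U|$. (ii) Sketching: $\hat L_s=\Omega\hat L+\Delta_s$, $|\Delta_s|\le\gamma_m(\mathbf u_b)|\Omega||\hat L|$. (iii) Thin Householder QR of $\hat L_s$: $\hat H\hat Y_0=\hat L_s+\Delta_h$, $\hat H\in\mathbb{R}^{s\times n}$, $\hat Y_0\in\mathbb{R}^{n\times n}$ upper triangular, $\|\Delta_h\|_F\le\gamma_{csn}(\mathbf u_b)\|\hat L_s\|_F$ with a positive constant $c$, and $\|\hat H^\top\hat H-I_n\|_F=\mathcal O(\mathbf u_b)$, taken to be at most $0.01$. (iv) $\hat Y_1=\hat Y_0\hat U+\Delta_y$, $|\Delta_y|\le\gamma_n(\mathbf u_b)|\hat Y_0||\hat U|$. (v) Row-wise triangular solves: $\hat W\hat Y_1=X+\Delta_x$, where the $i$-th rows $\hat w_i,x_i$ of $\hat W,X$ satisfy $\hat w_i(\hat Y_1+\Delta\hat Y_1^{(i)})=x_i$ with $|\Delta\hat Y_1^{(i)}|\le\gamma_n(\mathbf u)|\hat Y_1|$. Assumption on $\Omega$ and $\epsilon$: $\Omega$ is an $(\epsilon,p,n)$ oblivious $l_2$-subspace embedding and $\epsilon<\frac{1-\eta^2}{1+\eta^2}$, where $\eta=\max\{12.8\sqrt{mn\mathbf u+n(n+1)\mathbf u}+0.1,\ 10.44n\sqrt n\,\mathbf u+0.1,\ 0.105\}<1$. Size restrictions: with $c_1=\max(c,1)$, $t=1.02\,m\mathbf u_b\sqrt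 n\,\|\Omega\|_F$, $d=\max(\|\Omega\|_2,1)$, $$m\sqrt s\,\mathbf u_b\le\tfrac1{64},\qquad c_1sn\sqrt n\,\mathbf u_b\le\tfrac1{64},$$ $$\kappa_2(\hat L)\le\frac{(1-\epsilon)^{1/2}}{25.5t+25.5csn\sqrt n\,\mathbf u_b((1+\epsilon)^{1/2}+t)},$$ $$\kappa_2(\hat L)\kappa_2(\hat U)\le\frac{(1-\epsilon)^{1/2}}{23.6\,d\,n^2\mathbf u_c((1+\epsilon)^{1/2}+t)}\quad\text{for both }\mathbf u_c=\mathbf u_b\text{ and }\mathbf u_c=\mathbf u.$$ *)

theory Defs
  imports "HOL-Probability.Probability"
begin

text \<open>
  An \<open>m \<times> n\<close> real matrix is a \<open>real^'n^'m\<close>, abbreviated \<open>('m, 'n) rmat\<close> so that an index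
  type need be given its sort only once. On this type the library's \<open>norm\<close> is the Frobenius
  norm, and \<open>\<bar>A\<bar>\<close> and \<open>A \<le> B\<close> are the entrywise absolute value and the entrywise order.
\<close>

type_synonym ('m, 'n) rmat = "((real, 'n) vec, 'm) vec"

section \<open>Spectral norm, singular values, condition number\<close>

abbreviation spectral_norm :: "('m::finite, 'n::finite) rmat \<Rightarrow> real" where
  "spectral_norm A \<equiv> onorm ((*v) A)"

definition singular_space :: "('m::finite, 'n::finite) rmat \<Rightarrow> real \<Rightarrow> (real^'n) set" where
  "singular_space A \<tau> = {v. (transpose A ** A) *v v = \<tau>\<^sup>2 *\<^sub>R v}"

definition singular_values :: "('m::finite, 'n::finite) rmat \<Rightarrow> real set" where
  "singular_values A = {\<tau>. 0 \<le> \<tau> \<and> singular_space A \<tau> \<noteq> {0}}"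

text \<open>
  Decreasing, repeated according to multiplicity. The list has one entry per column of \<open>A\<close>,
  which is the usual count for matrices with at least as many rows as columns.
\<close>
definition singular_value_list :: "('m::finite, 'n::finite) rmat \<Rightarrow> real list" where
  "singular_value_list A = rev (sorted_list_of_multiset
     (\<Sum>\<tau>\<in>singular_values A. replicate_mset (dim (singular_space A \<tau>)) \<tau>))"

definition sing_val :: "nat \<Rightarrow> ('m::finite, 'n::finite) rmat \<Rightarrow> real" where
  "sing_val i A = singular_value_list A ! (i - 1)"

text \<open>
  Meaningful only if the \<open>n\<close>-th singular value is nonzero: HOL's division by zero would give \<open>0\<close>,
  not infinity, so bounds on \<open>cond2 A\<close> are accompanied by positivity of that singular value.
\<close>
definition cond2 :: "('m::finite, 'n::finite) rmat \<Rightarrow> real" where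
  "cond2 A = spectral_norm A / sing_val CARD('n) A"

section \<open>Sketching\<close>

text \<open>
  ``\<open>P\<close> holds with probability at least \<open>q\<close>''. If \<open>{\<omega> \<in> space M. P \<omega>}\<close> is measurable, this says that
  its measure is at least \<open>q\<close>. The form below needs no measurability of \<open>P\<close>, and hence none of the
  map that takes a sketch matrix to the computed matrices.
\<close>
definition with_prob_ge :: "'w measure \<Rightarrow> real \<Rightarrow> ('w \<Rightarrow> bool) \<Rightarrow> bool" where
  "with_prob_ge M q P \<longleftrightarrow> (\<exists>E\<in>sets M. measure M E \<ge> q \<and> (\<forall>\<omega>\<in>E. P \<omega>))"

definition subspace_embedding :: "real \<Rightarrow> ('s::finite, 'm::finite) rmat \<Rightarrow> (real^'m) set \<Rightarrow> bool" where
  "subspace_embedding \<epsilon> \<Omega> K \<longleftrightarrow>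
     (\<forall>x\<in>K. \<forall>y\<in>K. \<bar>x \<bullet> y - (\<Omega> *v x) \<bullet> (\<Omega> *v y)\<bar> \<le> \<epsilon> * norm x * norm y)"

definition oblivious_subspace_embedding ::
    "'w measure \<Rightarrow> ('w \<Rightarrow> ('s::finite, 'm::finite) rmat) \<Rightarrow> real \<Rightarrow> real \<Rightarrow> nat \<Rightarrow> bool" where
  "oblivious_subspace_embedding M \<Omega> \<epsilon> p n \<longleftrightarrow>
     (\<forall>K. subspace K \<and> dim K = n \<longrightarrow>
        with_prob_ge M (1 - p) (\<lambda>\<omega>. subspace_embedding \<epsilon> (\<Omega> \<omega>) K))"

section \<open>Matrix shapes\<close>

definition permutation_matrix :: "('m::finite, 'm) rmat \<Rightarrow> bool" where
  "permutation_matrix P \<longleftrightarrow> (\<exists>\<pi>. bij \<pi> \<and> P = (\<chi> i j. if j = \<pi> i then 1 else 0))"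

text \<open>
  Row and column indices live in different ordered finite types, so they are compared through their
  positions \<open>0, 1, \<dots>\<close> in the respective order.
\<close>
definition position :: "'k::{finite,linorder} \<Rightarrow> nat" where
  "position i = card {..<i}"

definition unit_lower_trapezoidal ::
    "('m::{finite,linorder}, 'n::{finite,linorder}) rmat \<Rightarrow> bool" where
  "unit_lower_trapezoidal L \<longleftrightarrow>
     (\<forall>i j. (position i = position j \<longrightarrow> L $ i $ j = 1) \<and>
            (position i < position j \<longrightarrow> L $ i $ j = 0))"

definition upper_triangular_mat :: "('n::{finite,linorder}, 'n) rmat \<Rightarrow> bool" where
  "upper_triangular_mat U \<longleftrightarrow> (\<forall>i j. j < i \<longrightarrow> U $ i $ j = 0)"

section \<open>Rounding model\<close>

definition gam :: "real \<Rightarrow> real \<Rightarrow> real" where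
  "gam k v = k * v / (1 - k * v)"

definition computed_lu ::
    "real \<Rightarrow> ('m::{finite,linorder}, 'n::{finite,linorder}) rmat \<Rightarrow>
     ('m, 'm) rmat \<Rightarrow> ('m, 'n) rmat \<Rightarrow> ('n, 'n) rmat \<Rightarrow> bool" where
  "computed_lu u X P L U \<longleftrightarrow>
     permutation_matrix P \<and> unit_lower_trapezoidal L \<and> upper_triangular_mat U \<and>
     (\<exists>D. L ** U = P ** X + D \<and> \<bar>D\<bar> \<le> gam (real CARD('n)) u *\<^sub>R (\<bar>L\<bar> ** \<bar>U\<bar>))"

definition computed_sketch ::
    "real \<Rightarrow> ('s::finite, 'm::finite) rmat \<Rightarrow> ('m, 'n::finite) rmat \<Rightarrow> ('s, 'n) rmat \<Rightarrow> bool" where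
  "computed_sketch ub \<Omega> L Ls \<longleftrightarrow>
     (\<exists>D. Ls = \<Omega> ** L + D \<and> \<bar>D\<bar> \<le> gam (real CARD('m)) ub *\<^sub>R (\<bar>\<Omega>\<bar> ** \<bar>L\<bar>))"

definition computed_qr ::
    "real \<Rightarrow> real \<Rightarrow> ('s::finite, 'n::{finite,linorder}) rmat \<Rightarrow> ('s, 'n) rmat \<Rightarrow> ('n, 'n) rmat \<Rightarrow> bool" where
  "computed_qr ub c Ls H Y0 \<longleftrightarrow>
     upper_triangular_mat Y0 \<and>
     (\<exists>D. H ** Y0 = Ls + D \<and>
          norm D \<le> gam (c * real CARD('s) * real CARD('n)) ub * norm Ls) \<and>
     norm (transpose H ** H - mat 1) \<le> 0.01"

definition computed_product ::
    "real \<Rightarrow> ('n::finite, 'n) rmat \<Rightarrow> ('n, 'n) rmat \<Rightarrow> ('n, 'n) rmat \<Rightarrow> bool" where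
  "computed_product ub Y0 U Y1 \<longleftrightarrow>
     (\<exists>D. Y1 = Y0 ** U + D \<and> \<bar>D\<bar> \<le> gam (real CARD('n)) ub *\<^sub>R (\<bar>Y0\<bar> ** \<bar>U\<bar>))"

text \<open>
  One backward error \<open>D\<close> per row. The relation \<open>W ** Y1 = X + \<Delta>\<^sub>x\<close> merely names the residual
  \<open>\<Delta>\<^sub>x = W ** Y1 - X\<close> and imposes nothing further.
\<close>
definition computed_solve ::
    "real \<Rightarrow> ('m::finite, 'n::finite) rmat \<Rightarrow> ('n, 'n) rmat \<Rightarrow> ('m, 'n) rmat \<Rightarrow> bool" where
  "computed_solve u X Y1 W \<longleftrightarrow>
     (\<forall>i. \<exists>D. row i W v* (Y1 + D) = row i X \<and> \<bar>D\<bar> \<le> gam (real CARD('n)) u *\<^sub>R \<bar>Y1\<bar>)"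

text \<open>
  The steps that depend on the sketch matrix; the LU factors do not, and are parameters here.
  Together with \<open>cond_restrictions\<close> below, this is a condition on a single realization of the sketch
  matrix. It is therefore imposed realization by realization and not almost surely: \<open>\<Omega> X\<close> may be rank
  deficient or \<open>norm \<Omega>\<close> large with positive probability.
\<close>
definition computed_preconditioner ::
    "real \<Rightarrow> real \<Rightarrow> real \<Rightarrow> ('m::finite, 'n::{finite,linorder}) rmat \<Rightarrow> ('m, 'n) rmat \<Rightarrow>
     ('n, 'n) rmat \<Rightarrow> ('s::finite, 'm) rmat \<Rightarrow> ('s, 'n) rmat \<Rightarrow> ('s, 'n) rmat \<Rightarrow>
     ('n, 'n) rmat \<Rightarrow> ('n, 'n) rmat \<Rightarrow> ('m, 'n) rmat \<Rightarrow> bool" where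
  "computed_preconditioner u ub c X L U \<Omega> Ls H Y0 Y1 W \<longleftrightarrow>
     computed_sketch ub \<Omega> L Ls \<and>
     computed_qr ub c Ls H Y0 \<and>
     computed_product ub Y0 U Y1 \<and>
     computed_solve u X Y1 W"

section \<open>Assumptions on the parameters\<close>

definition eta :: "real \<Rightarrow> real \<Rightarrow> real \<Rightarrow> real" where
  "eta m n u = Max {12.8 * sqrt (m * n * u + n * (n + 1) * u) + 0.1,
                    10.44 * n * sqrt n * u + 0.1,
                    0.105}"

definition sketch_err :: "real \<Rightarrow> nat \<Rightarrow> ('s::finite, 'm::finite) rmat \<Rightarrow> real" where
  "sketch_err ub n \<Omega> = 1.02 * real CARD('m) * ub * sqrt (real n) * norm \<Omega>"

text \<open>
  Positivity of the last singular values expresses that the condition numbers are finite; for a unit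
  lower trapezoidal \<open>L\<close> with at least as many rows as columns it is automatic.
\<close>
definition cond_restrictions ::
    "real \<Rightarrow> real \<Rightarrow> real \<Rightarrow> real \<Rightarrow> ('m::finite, 'n::finite) rmat \<Rightarrow> ('n, 'n) rmat \<Rightarrow>
     ('s::finite, 'm) rmat \<Rightarrow> bool" where
  "cond_restrictions \<epsilon> u ub c L U \<Omega> \<longleftrightarrow>
     (let n = real CARD('n); s = real CARD('s);
          t = sketch_err ub CARD('n) \<Omega>;
          d = max (spectral_norm \<Omega>) 1
      in sing_val CARD('n) L > 0 \<and> sing_val CARD('n) U > 0 \<and>
         cond2 L \<le> sqrt (1 - \<epsilon>) /
           (25.5 * t + 25.5 * c * s * n * sqrt n * ub * (sqrt (1 + \<epsilon>) + t)) \<and>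
         (\<forall>uc\<in>{ub, u}. cond2 L * cond2 U \<le> sqrt (1 - \<epsilon>) /
           (23.6 * d * n\<^sup>2 * uc * (sqrt (1 + \<epsilon>) + t))))"

end

theory Submission
  imports Defs
begin

text \<open>
  The only random event needed is that \<open>\<Omega>\<close> embeds the range of \<open>L\<close>, which has probability at least
  \<open>1 - p \<ge> (1 - p)\<^sup>2\<close>. On it, all computed quantities are compared with \<open>norm (L U z)\<close>. The condition
  number restrictions make every rounding error a few percent of this reference: first
  \<open>norm (Y0 v)\<close> lies between constant multiples of \<open>sqrt (1 - \<epsilon>) norm (L v)\<close> and
  \<open>sqrt (1 + \<epsilon>) norm (L v)\<close>, hence so does \<open>norm (Y1 z)\<close> with \<open>L U z\<close> in place of \<open>L v\<close>, while
  \<open>norm (X z)\<close> is \<open>norm (L U z)\<close> up to 4.33 percent. As \<open>W Y1 z\<close> is \<open>X z\<close> up to a residual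
  proportional to \<open>norm W\<close>, the upper bound is an inequality \<open>norm W \<le> a + b norm W\<close> with \<open>b < 1\<close>,
  and the lower bound follows from it. The last singular value is turned into the minimal stretch
  by diagonalizing \<open>A\<^sup>T A\<close>.
\<close>

section \<open>Singular values\<close>

lemma gram_inner:
  fixes A :: "('m::finite, 'n::finite) rmat"
  shows "((transpose A ** A) *v x) \<bullet> y = (A *v x) \<bullet> (A *v y)"
  by (metis dot_lmul_matrix inner_commute matrix_vector_mul_assoc transpose_matrix_vector)

lemma subspace_singular_space: "subspace (singular_space A \<tau>)"
  unfolding singular_space_def subspace_def
  by (auto simp: matrix_vector_right_distrib scaleR_right_distrib matrix_vector_mult_scaleR)

lemma norm_singular_space:
  assumes "v \<in> singular_space A \<tau>" "0 \<le> \<tau>"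
  shows "norm (A *v v) = \<tau> * norm v"
proof -
  have "(norm (A *v v))\<^sup>2 = (\<tau> * norm v)\<^sup>2"
    using assms(1) gram_inner[of A v v]
    by (simp add: singular_space_def power2_norm_eq_inner power_mult_distrib)
  then show ?thesis using assms(2) by (simp add: power2_eq_iff_nonneg)
qed

text \<open>The Gram matrix is symmetric, so it can be moved to either factor of
  \<open>v \<bullet> w\<close>. Nonnegativity makes the squares of distinct \<open>\<tau>\<close>,
  \<open>\<tau>'\<close> distinct.\<close>

lemma orthogonal_singular_space:
  assumes "v \<in> singular_space A \<tau>" "w \<in> singular_space A \<tau>'" "0 \<le> \<tau>" "0 \<le> \<tau>'" "\<tau> \<noteq> \<tau>'"
  shows "v \<bullet> w = 0"
proof -
  have "\<tau>\<^sup>2 * (v \<bullet> w) = \<tau>'\<^sup>2 * (v \<bullet> w)"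
    using assms(1,2) gram_inner[of A v w] gram_inner[of A w v]
    by (simp add: singular_space_def inner_commute)
  then show ?thesis using assms(3-5) by (simp add: power2_eq_iff_nonneg)
qed

text \<open>A minimizer \<open>x\<close> of the Rayleigh quotient on an invariant subspace is an eigenvector: the
  quadratic form \<open>norm (A y)\<^sup>2 - \<tau>\<^sup>2 norm y\<^sup>2\<close> is nonnegative and vanishes at \<open>x\<close>, so its
  polarization against \<open>x\<close> vanishes too.\<close>

lemma minimal_singular_vector:
  fixes A :: "('m::finite, 'n::finite) rmat"
  assumes S: "subspace S" "S \<noteq> {0}"
    and inv: "\<And>x. x \<in> S \<Longrightarrow> (transpose A ** A) *v x \<in> S"
  obtains x \<tau> where "x \<in> S" "x \<noteq> 0" "0 \<le> \<tau>" "x \<in> singular_space A \<tau>"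
    "\<And>y. y \<in> S \<Longrightarrow> \<tau> * norm y \<le> norm (A *v y)"
proof -
  define T where "T = S \<inter> sphere 0 1"
  have "compact T" unfolding T_def
    using closed_subspace[OF S(1)] compact_sphere by (simp add: closed_Int_compact)
  obtain s where s: "s \<in> S" "s \<noteq> 0" using S subspace_0 by blast
  have "s /\<^sub>R norm s \<in> T" using s S(1) by (simp add: T_def subspace_scale)
  then have "T \<noteq> {}" by blast
  have "continuous_on T (\<lambda>x. norm (A *v x))"
    by (intro continuous_intros linear_continuous_on_compose[OF _ matrix_vector_mul_linear])
  then obtain x where x: "x \<in> T" and xmin: "\<And>y. y \<in> T \<Longrightarrow> norm (A *v x) \<le> norm (A *v y)"
    using continuous_attains_inf[OF \<open>compact T\<close> \<open>T \<noteq> {}\<close>] by metis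
  define \<tau> where "\<tau> = norm (A *v x)"
  have nx: "norm x = 1" "x \<in> S" using x by (auto simp: T_def)
  have min: "\<tau> * norm y \<le> norm (A *v y)" if "y \<in> S" for y
  proof (cases "y = 0")
    case False
    then have "y /\<^sub>R norm y \<in> T" using that S(1) by (simp add: T_def subspace_scale)
    then have "\<tau> \<le> norm (A *v (y /\<^sub>R norm y))" using xmin \<tau>_def by blast
    then show ?thesis using False by (simp add: matrix_vector_mult_scaleR field_simps)
  qed simp
  define w where "w = (transpose A ** A) *v x - \<tau>\<^sup>2 *\<^sub>R x"
  have wS: "w \<in> S" using inv nx S(1) by (simp add: w_def subspace_diff subspace_scale)
  define q where "q y = (A *v y) \<bullet> (A *v y) - \<tau>\<^sup>2 * (y \<bullet> y)" for y
  have q0: "0 \<le> q y" if "y \<in> S" for y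
  proof -
    have "(\<tau> * norm y)\<^sup>2 \<le> (norm (A *v y))\<^sup>2"
      using min[OF that] by (intro power_mono) (auto simp: \<tau>_def)
    then show ?thesis by (simp add: q_def power_mult_distrib power2_norm_eq_inner)
  qed
  have qx: "q x = 0" using nx by (simp add: q_def \<tau>_def flip: power2_norm_eq_inner)
  have expand: "q (x + r *\<^sub>R w) = q x + 2 * r * (w \<bullet> w) + r\<^sup>2 * q w" for r
  proof -
    have "w \<bullet> w = (A *v x) \<bullet> (A *v w) - \<tau>\<^sup>2 * (x \<bullet> w)"
      by (subst (1) w_def) (simp add: inner_diff_left gram_inner)
    moreover have "q (x + r *\<^sub>R w) =
        q x + 2 * r * ((A *v x) \<bullet> (A *v w) - \<tau>\<^sup>2 * (x \<bullet> w)) + r\<^sup>2 * q w"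
      by (simp add: q_def matrix_vector_right_distrib matrix_vector_mult_scaleR inner_simps
          inner_commute algebra_simps power2_eq_square)
    ultimately show ?thesis by simp
  qed
  have "w \<bullet> w = 0"
  proof (rule ccontr)
    assume "w \<bullet> w \<noteq> 0"
    then have pos: "0 < w \<bullet> w" by simp
    have qw: "0 \<le> q w" using q0 wS by blast
    \<comment> \<open>For negative \<open>r\<close> this close to \<open>0\<close> the linear term
      outweighs the quadratic one; the summand \<open>1\<close> covers
      \<open>q w = 0\<close>.\<close>
    define r where "r = - (w \<bullet> w) / (q w + 1)"
    have "0 \<le> q (x + r *\<^sub>R w)" using nx wS S(1) by (intro q0) (simp add: subspace_add subspace_scale)
    then have "0 \<le> r * (2 * (w \<bullet> w) + r * q w)"
      using expand[of r] qx by (simp add: algebra_simps power2_eq_square)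
    moreover have "r < 0" using pos qw by (simp add: r_def divide_neg_pos)
    moreover have "2 * (w \<bullet> w) + r * q w > 0"
    proof -
      have "(w \<bullet> w) * (q w / (q w + 1)) \<le> (w \<bullet> w) * 1"
        using pos qw by (intro mult_left_mono) auto
      moreover have "r * q w = - ((w \<bullet> w) * (q w / (q w + 1)))" by (simp add: r_def)
      ultimately show ?thesis using pos by linarith
    qed
    ultimately show False by (smt (verit) mult_neg_pos)
  qed
  then have "x \<in> singular_space A \<tau>" by (simp add: w_def singular_space_def)
  moreover have "x \<noteq> 0" using nx by auto
  ultimately show ?thesis using that[of x \<tau>] nx min by (simp add: \<tau>_def)
qed

text \<open>Spectral theorem for the Gram matrix, by counting: orthogonal bases of the singular
  spaces unite to an independent set \<open>C\<close>. If \<open>C\<close> did not span, its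
  orthogonal complement would be invariant and contain one more singular vector.\<close>

lemma finite_singular_values: "finite (singular_values (A :: ('m::finite, 'n::finite) rmat))"
  and sum_dim_singular_spaces:
    "(\<Sum>\<tau>\<in>singular_values A. dim (singular_space A \<tau>)) = CARD('n)"
proof -
  have "\<forall>\<tau>. \<exists>B. 0 \<notin> B \<and> B \<subseteq> singular_space A \<tau> \<and> pairwise orthogonal B \<and> independent B \<and>
      card B = dim (singular_space A \<tau>) \<and> span B = singular_space A \<tau>"
    using orthogonal_basis_subspace[OF subspace_singular_space]
    by (metis dependent_zero)
  then obtain B where B0: "\<And>\<tau>. 0 \<notin> B \<tau>" and Bsub: "\<And>\<tau>. B \<tau> \<subseteq> singular_space A \<tau>"
    and Borth: "\<And>\<tau>. pairwise orthogonal (B \<tau>)"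
    and Bindep: "\<And>\<tau>. independent (B \<tau>)"
    and Bcard: "\<And>\<tau>. card (B \<tau>) = dim (singular_space A \<tau>)"
    and Bspan: "\<And>\<tau>. span (B \<tau>) = singular_space A \<tau>"
    by metis
  let ?S = "singular_values A"
  define C where "C = (\<Union>\<tau>\<in>?S. B \<tau>)"
  have cross: "v \<bullet> w = 0" if "v \<in> B \<tau>" "w \<in> B \<tau>'" "\<tau> \<in> ?S" "\<tau>' \<in> ?S" "\<tau> \<noteq> \<tau>'" for v w \<tau> \<tau>'
    by (rule orthogonal_singular_space[of _ A \<tau> _ \<tau>'])
      (use that Bsub in \<open>auto simp: singular_values_def\<close>)
  have "pairwise orthogonal C"
    unfolding pairwise_def C_def orthogonal_def
    using cross Borth by (metis (no_types, opaque_lifting) UN_E orthogonal_def pairwiseD)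
  then have indep: "independent C"
    using pairwise_orthogonal_independent B0 by (auto simp: C_def)
  then have finC: "finite C" using independent_imp_finite by blast
  have disj: "B \<tau> \<inter> B \<tau>' = {}" if "\<tau> \<in> ?S" "\<tau>' \<in> ?S" "\<tau> \<noteq> \<tau>'" for \<tau> \<tau>'
    using cross[OF _ _ that] B0 by (metis disjoint_iff inner_eq_zero_iff)
  have ne: "B \<tau> \<noteq> {}" if "\<tau> \<in> ?S" for \<tau>
    using that Bspan[of \<tau>] by (auto simp: singular_values_def)
  \<comment> \<open>\<open>B\<close> sends distinct singular values to disjoint nonempty subsets of
    the finite set \<open>C\<close>.\<close>
  show fin: "finite ?S"
  proof (rule inj_on_finite[of B _ "Pow C"])
    show "inj_on B ?S" using disj ne by (metis inf.idem inj_onI)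
  qed (use finC in \<open>auto simp: C_def\<close>)
  have inS: "singular_space A \<tau> \<subseteq> span C" if "\<tau> \<in> ?S" for \<tau>
    using that Bspan[of \<tau>] span_mono[of "B \<tau>" C] by (auto simp: C_def)
  have invC: "(transpose A ** A) *v x \<in> span C" if "x \<in> span C" for x
    using that
  proof (induction rule: span_induct_alt)
    case (step c b y)
    then obtain \<tau> where "\<tau> \<in> ?S" "b \<in> B \<tau>" by (auto simp: C_def)
    then have "(transpose A ** A) *v b = \<tau>\<^sup>2 *\<^sub>R b"
      using Bsub by (auto simp: singular_space_def)
    then have "(transpose A ** A) *v (c *\<^sub>R b + y) = (c * \<tau>\<^sup>2) *\<^sub>R b + (transpose A ** A) *v y"
      by (simp add: matrix_vector_right_distrib matrix_vector_mult_scaleR)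
    then show ?case using step by (simp add: span_add span_base span_scale)
  qed (simp add: span_zero)
  define N where "N = {y. \<forall>x\<in>span C. orthogonal x y}"
  have "N = {0}"
  proof (rule ccontr)
    assume N_ne: "N \<noteq> {0}"
    have N_sub: "subspace N" unfolding N_def by (rule subspace_orthogonal_to_vectors)
    \<comment> \<open>The complement of an invariant subspace is invariant because the Gram matrix
      is self-adjoint.\<close>
    have N_inv: "(transpose A ** A) *v y \<in> N" if "y \<in> N" for y
      unfolding N_def orthogonal_def
    proof (intro CollectI ballI)
      fix x assume "x \<in> span C"
      then have "((transpose A ** A) *v x) \<bullet> y = 0"
        using that invC by (simp add: N_def orthogonal_def)
      then show "x \<bullet> ((transpose A ** A) *v y) = 0"
        using gram_inner[of A x y] gram_inner[of A y x] by (simp add: inner_commute)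
    qed
    obtain x \<tau> where x: "x \<in> N" "x \<noteq> 0" "0 \<le> \<tau>" "x \<in> singular_space A \<tau>"
      using minimal_singular_vector[OF N_sub N_ne N_inv] by blast
    then have "\<tau> \<in> ?S" by (auto simp: singular_values_def)
    then have "x \<in> span C" using inS x by blast
    then show False using x by (auto simp: N_def orthogonal_def)
  qed
  then have "dim (span C) = CARD('n)"
    using dim_subspace_orthogonal_to_vectors[of "span C" UNIV] by (simp add: N_def)
  then have "card C = CARD('n)" using indep by (simp add: dim_eq_card_independent)
  moreover have "card C = (\<Sum>\<tau>\<in>?S. card (B \<tau>))"
    unfolding C_def using fin disj independent_imp_finite[OF Bindep]
    by (intro card_UN_disjoint) auto
  ultimately show "(\<Sum>\<tau>\<in>?S. dim (singular_space A \<tau>)) = CARD('n)"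
    by (simp add: Bcard)
qed

lemma length_singular_value_list:
  fixes A :: "('m::finite, 'n::finite) rmat"
  shows "length (singular_value_list A) = CARD('n)"
proof -
  have "length (sorted_list_of_multiset N) = size N" for N :: "real multiset"
    by (metis mset_sorted_list_of_multiset size_mset)
  then show ?thesis
    by (simp add: singular_value_list_def sum_dim_singular_spaces size_multiset_sum)
qed

lemma set_singular_value_list: "set (singular_value_list A) = singular_values A"
proof -
  have "dim (singular_space A \<tau>) \<noteq> 0" if "\<tau> \<in> singular_values A" for \<tau>
    using that subspace_0[OF subspace_singular_space, of A \<tau>]
    by (auto simp: singular_values_def)
  then show ?thesis
    using finite_singular_values[of A]
    by (auto simp: singular_value_list_def set_mset_sum split: if_splits)
qed

text \<open>The list is decreasing and has exactly \<open>CARD('n)\<close> entries, so index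
  \<open>CARD('n) - 1\<close> picks its last and smallest entry.\<close>

lemma
  fixes A :: "('m::finite, 'n::finite) rmat"
  shows last_sing_val_mem: "sing_val CARD('n) A \<in> singular_values A"
    and last_sing_val_le: "\<tau> \<in> singular_values A \<Longrightarrow> sing_val CARD('n) A \<le> \<tau>"
proof -
  let ?l = "singular_value_list A"
  have n: "0 < CARD('n)" by simp
  then have ne: "?l \<noteq> []" using length_singular_value_list[of A] by force
  have sv: "sing_val CARD('n) A = last ?l"
    using ne by (simp add: sing_val_def last_conv_nth length_singular_value_list)
  then show "sing_val CARD('n) A \<in> singular_values A"
    using last_in_set[OF ne] by (simp add: set_singular_value_list)
  assume "\<tau> \<in> singular_values A"
  then have "\<tau> \<in> set (rev ?l)" by (simp add: set_singular_value_list)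
  moreover have "sorted (rev ?l)" by (simp add: singular_value_list_def)
  moreover have "last ?l = hd (rev ?l)" by (simp add: hd_rev)
  ultimately show "sing_val CARD('n) A \<le> \<tau>" unfolding sv
    by (cases "rev ?l") auto
qed

text \<open>The Rayleigh minimizer on the whole space yields a singular value that bounds the
  stretch from below; the last singular value does not exceed it.\<close>

lemma last_sing_val_stretch:
  fixes A :: "('m::finite, 'n::finite) rmat"
  shows "sing_val CARD('n) A * norm v \<le> norm (A *v v)"
proof -
  have "(UNIV :: (real^'n) set) \<noteq> {0}"
    by (metis UNIV_I axis_eq_0_iff singletonD zero_neq_one)
  then obtain x \<tau> where "x \<noteq> 0" "0 \<le> \<tau>" "x \<in> singular_space A \<tau>"
    and min: "\<And>y. \<tau> * norm y \<le> norm (A *v y)"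
    using minimal_singular_vector[of UNIV A] by auto
  then have "sing_val CARD('n) A \<le> \<tau>"
    by (intro last_sing_val_le) (auto simp: singular_values_def)
  then show ?thesis using min[of v] by (meson mult_right_mono norm_ge_zero order_trans)
qed

text \<open>It suffices to test the assumption on a singular vector of the last singular
  value.\<close>

lemma last_sing_val_ge:
  fixes A :: "('m::finite, 'n::finite) rmat"
  assumes "\<And>v. b * norm v \<le> norm (A *v v)"
  shows "b \<le> sing_val CARD('n) A"
proof -
  let ?s = "sing_val CARD('n) A"
  have s: "0 \<le> ?s" "singular_space A ?s \<noteq> {0}"
    using last_sing_val_mem[of A] by (auto simp: singular_values_def)
  then obtain v where "v \<in> singular_space A ?s" "v \<noteq> 0"
    using subspace_0[OF subspace_singular_space] by blast
  then show ?thesis using assms[of v] norm_singular_space s(1) by fastforce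
qed

section \<open>Spectral and Frobenius norms\<close>

lemma spectral_norm_bound: "norm (A *v x) \<le> spectral_norm A * norm x"
  by (rule onorm[OF matrix_vector_mul_bounded_linear])

lemma spectral_norm_nonneg: "0 \<le> spectral_norm A"
  by (rule onorm_pos_le[OF matrix_vector_mul_bounded_linear])

lemma frobenius_norm_sq: "(norm A)\<^sup>2 = (\<Sum>i\<in>UNIV. \<Sum>j\<in>UNIV. (A $ i $ j)\<^sup>2)"
  for A :: "('m::finite, 'n::finite) rmat"
  by (simp add: norm_vec_def L2_set_def sum_nonneg)

lemma frobenius_norm_transpose: "norm (transpose A) = norm A"
  for A :: "('m::finite, 'n::finite) rmat"
proof -
  have "(norm (transpose A))\<^sup>2 = (norm A)\<^sup>2"
    unfolding frobenius_norm_sq by (subst sum.swap) (simp add: transpose_def)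
  then show ?thesis by (simp add: power2_eq_iff_nonneg)
qed

lemma norm_matrix_vector_le: "norm (A *v x) \<le> norm A * norm x"
  for A :: "('m::finite, 'n::finite) rmat"
proof -
  have "norm (A *v x) \<le> L2_set (\<lambda>i. norm (A $ i) * norm x) UNIV"
    unfolding norm_vec_def[of "A *v x"]
    by (intro L2_set_mono) (simp_all add: matrix_vector_mul_component Cauchy_Schwarz_ineq2)
  also have "\<dots> = norm A * norm x"
    by (simp add: L2_set_left_distrib norm_vec_def[of A])
  finally show ?thesis .
qed

text \<open>Row \<open>i\<close> of the product is \<open>transpose B\<close> applied to row
  \<open>i\<close> of \<open>A\<close>.\<close>

lemma frobenius_norm_mult: "norm (A ** B) \<le> norm A * norm B"
  for A :: "('m::finite, 'k::finite) rmat" and B :: "('k, 'n::finite) rmat"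
proof -
  have "norm ((A ** B) $ i) \<le> norm (A $ i) * norm B" for i
  proof -
    have "(A ** B) $ i = transpose B *v (A $ i)"
      by (simp add: vec_eq_iff matrix_matrix_mult_def matrix_vector_mult_def transpose_def mult.commute)
    then show ?thesis
      using norm_matrix_vector_le[of "transpose B" "A $ i"]
      by (simp add: frobenius_norm_transpose mult.commute)
  qed
  then have "norm (A ** B) \<le> L2_set (\<lambda>i. norm (A $ i) * norm B) UNIV"
    unfolding norm_vec_def[of "A ** B"] by (intro L2_set_mono) auto
  also have "\<dots> = norm A * norm B"
    by (simp add: L2_set_left_distrib norm_vec_def[of A])
  finally show ?thesis .
qed

text \<open>Each of the \<open>CARD('n)\<close> columns is the image of a unit vector.\<close>

lemma frobenius_norm_le_spectral: "norm A \<le> sqrt (real CARD('n)) * spectral_norm A"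
  for A :: "('m::finite, 'n::finite) rmat"
proof -
  have col: "(\<Sum>i\<in>UNIV. (A $ i $ j)\<^sup>2) \<le> (spectral_norm A)\<^sup>2" for j
  proof -
    have "norm (A *v axis j 1) \<le> spectral_norm A"
      using spectral_norm_bound[of A "axis j 1"] by simp
    then have "(norm (column j A))\<^sup>2 \<le> (spectral_norm A)\<^sup>2"
      by (intro power_mono) (auto simp: matrix_vector_mult_basis)
    then show ?thesis by (simp add: norm_vec_def L2_set_def sum_nonneg column_def)
  qed
  have "(norm A)\<^sup>2 = (\<Sum>j\<in>UNIV. \<Sum>i\<in>UNIV. (A $ i $ j)\<^sup>2)"
    unfolding frobenius_norm_sq by (rule sum.swap)
  also have "\<dots> \<le> (\<Sum>j\<in>(UNIV::'n set). (spectral_norm A)\<^sup>2)" by (intro sum_mono col)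
  also have "\<dots> = (sqrt (real CARD('n)) * spectral_norm A)\<^sup>2" by (simp add: power_mult_distrib)
  finally show ?thesis by (rule power2_le_imp_le) (simp add: spectral_norm_nonneg)
qed

lemma frobenius_norm_abs: "norm \<bar>A\<bar> = norm A"
  for A :: "('m::finite, 'n::finite) rmat"
proof -
  have "(norm \<bar>A\<bar>)\<^sup>2 = (norm A)\<^sup>2" by (simp add: frobenius_norm_sq abs_vec_def)
  then show ?thesis by (simp add: power2_eq_iff_nonneg)
qed

lemma abs_matrix_le_iff: "\<bar>D\<bar> \<le> E \<longleftrightarrow> (\<forall>i j. \<bar>D $ i $ j\<bar> \<le> E $ i $ j)"
  for D :: "('m::finite, 'n::finite) rmat"
  by (simp add: less_eq_vec_def abs_vec_def)

text \<open>Here \<open>g\<close> stands for a value of \<open>gam\<close>, whose sign is not known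
  a priori, and \<open>h\<close> for its nonnegative linear majorant.\<close>

lemma componentwise_error_bound:
  fixes D :: "('m::finite, 'n::finite) rmat" and A :: "('m, 'k::finite) rmat"
  assumes D: "\<bar>D\<bar> \<le> g *\<^sub>R (\<bar>A\<bar> ** \<bar>B\<bar>)" and g: "g \<le> h" "0 \<le> h"
  shows "norm D \<le> h * (norm A * norm B)"
proof -
  let ?E = "\<bar>A\<bar> ** \<bar>B\<bar>"
  have E0: "0 \<le> ?E $ i $ j" for i j
    by (simp add: matrix_matrix_mult_def abs_vec_def sum_nonneg)
  have "\<bar>D $ i $ j\<bar> \<le> \<bar>h * ?E $ i $ j\<bar>" for i j
    using D g E0[of i j] mult_right_mono[OF g(1) E0[of i j]]
    unfolding abs_matrix_le_iff by (simp add: abs_mult) (smt (verit))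
  then have "(norm D)\<^sup>2 \<le> (norm (h *\<^sub>R ?E))\<^sup>2"
    unfolding frobenius_norm_sq by (intro sum_mono) (simp add: abs_le_square_iff)
  then have "norm D \<le> norm (h *\<^sub>R ?E)" by (rule power2_le_imp_le) simp
  also have "\<dots> = h * norm ?E" using g by simp
  also have "\<dots> \<le> h * (norm A * norm B)"
    using g frobenius_norm_mult[of "\<bar>A\<bar>" "\<bar>B\<bar>"] by (intro mult_left_mono) (simp_all add: frobenius_norm_abs)
  finally show ?thesis .
qed

section \<open>Isometries, near-isometries and the residual of the solves\<close>

lemma norm_permutation_matrix:
  assumes "permutation_matrix P"
  shows "norm (P *v x) = norm x"
proof -
  obtain \<pi> where \<pi>: "bij \<pi>" "P = (\<chi> i j. if j = \<pi> i then 1 else 0)"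
    using assms by (auto simp: permutation_matrix_def)
  have "(P *v x) $ i = x $ \<pi> i" for i
    by (simp add: \<pi>(2) matrix_vector_mult_def if_distrib[of "\<lambda>a. a * _"] cong: if_cong)
  then have "norm (P *v x) = L2_set (\<lambda>i. norm (x $ \<pi> i)) UNIV" by (simp add: norm_vec_def)
  also have "\<dots> = norm x"
    unfolding norm_vec_def L2_set_def
    by (subst sum.reindex_bij_betw[OF \<pi>(1), of "\<lambda>j. (norm (x $ j))\<^sup>2"]) (rule refl)
  finally show ?thesis .
qed

text \<open>The quadratic form of \<open>transpose H ** H - mat 1\<close> is the change of the
  squared norm. The constants satisfy \<open>0.994\<^sup>2 \<le> 0.99\<close> and
  \<open>1.01 \<le> 1.005\<^sup>2\<close>.\<close>

lemma near_orthonormal_stretch: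
  fixes H :: "('s::finite, 'n::finite) rmat"
  assumes "norm (transpose H ** H - mat 1) \<le> 0.01"
  shows "0.994 * norm z \<le> norm (H *v z)" and "norm (H *v z) \<le> 1.005 * norm z"
proof -
  have "\<bar>(norm (H *v z))\<^sup>2 - (norm z)\<^sup>2\<bar> = \<bar>((transpose H ** H - mat 1) *v z) \<bullet> z\<bar>"
    by (simp add: matrix_vector_mult_diff_rdistrib inner_diff_left gram_inner power2_norm_eq_inner)
  also have "\<dots> \<le> norm ((transpose H ** H - mat 1) *v z) * norm z" by (rule Cauchy_Schwarz_ineq2)
  also have "\<dots> \<le> (0.01 * norm z) * norm z"
    using norm_matrix_vector_le[of "transpose H ** H - mat 1" z]
      mult_right_mono[OF assms norm_ge_zero[of z]]
    by (intro mult_right_mono norm_ge_zero) linarith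
  finally have *: "\<bar>(norm (H *v z))\<^sup>2 - (norm z)\<^sup>2\<bar> \<le> 0.01 * (norm z)\<^sup>2"
    by (simp add: power2_eq_square)
  have "(0.994 * norm z)\<^sup>2 \<le> (norm (H *v z))\<^sup>2"
    using * unfolding power_mult_distrib by (simp add: power2_eq_square[of "497/500"]) (smt (verit) zero_le_power2)
  then show "0.994 * norm z \<le> norm (H *v z)" by (rule power2_le_imp_le) simp
  have "(norm (H *v z))\<^sup>2 \<le> (1.005 * norm z)\<^sup>2"
    using * unfolding power_mult_distrib by (simp add: power2_eq_square[of "201/200"]) (smt (verit) zero_le_power2)
  then show "norm (H *v z) \<le> 1.005 * norm z" by (rule power2_le_imp_le) simp
qed

lemma subspace_embedding_stretch:
  assumes "subspace_embedding \<epsilon> \<Omega> K" "x \<in> K" "0 \<le> \<epsilon>" "\<epsilon> < 1"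
  shows "sqrt (1 - \<epsilon>) * norm x \<le> norm (\<Omega> *v x)" and "norm (\<Omega> *v x) \<le> sqrt (1 + \<epsilon>) * norm x"
proof -
  have "\<bar>x \<bullet> x - (\<Omega> *v x) \<bullet> (\<Omega> *v x)\<bar> \<le> \<epsilon> * norm x * norm x"
    using assms(1,2) unfolding subspace_embedding_def by blast
  then have *: "\<bar>(norm x)\<^sup>2 - (norm (\<Omega> *v x))\<^sup>2\<bar> \<le> \<epsilon> * (norm x)\<^sup>2"
    unfolding power2_norm_eq_inner[symmetric] by (simp only: power2_eq_square mult.assoc)
  have "(sqrt (1 - \<epsilon>) * norm x)\<^sup>2 \<le> (norm (\<Omega> *v x))\<^sup>2"
    using * assms by (simp add: power_mult_distrib algebra_simps abs_le_iff)
  then show "sqrt (1 - \<epsilon>) * norm x \<le> norm (\<Omega> *v x)" by (rule power2_le_imp_le) simp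
  have "(norm (\<Omega> *v x))\<^sup>2 \<le> (sqrt (1 + \<epsilon>) * norm x)\<^sup>2"
    using * assms by (simp add: power_mult_distrib algebra_simps abs_le_iff)
  then show "norm (\<Omega> *v x) \<le> sqrt (1 + \<epsilon>) * norm x" by (rule power2_le_imp_le) (use assms in simp)
qed

text \<open>Row \<open>i\<close> of the residual is \<open>- (row i W v* D)\<close> with the
  \<open>D\<close> of that row. All these \<open>D\<close> obey the same bound, so they combine into
  one matrix inequality.\<close>

lemma computed_solve_residual:
  fixes W X :: "('m::finite, 'n::finite) rmat"
  assumes "computed_solve u X Y1 W"
  shows "\<bar>W ** Y1 - X\<bar> \<le> gam (real CARD('n)) u *\<^sub>R (\<bar>W\<bar> ** \<bar>Y1\<bar>)"
  unfolding abs_matrix_le_iff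
proof (intro allI)
  fix i j
  let ?g = "gam (real CARD('n)) u"
  obtain D where D: "row i W v* (Y1 + D) = row i X" "\<bar>D\<bar> \<le> ?g *\<^sub>R \<bar>Y1\<bar>"
    using assms by (auto simp: computed_solve_def)
  have "(row i W v* (Y1 + D)) $ j = X $ i $ j" unfolding D(1) by (simp add: row_def)
  then have "(W ** Y1 - X) $ i $ j = - (\<Sum>k\<in>UNIV. W $ i $ k * D $ k $ j)"
    by (simp add: vector_matrix_mult_def matrix_matrix_mult_def row_def algebra_simps sum.distrib)
  then have "\<bar>(W ** Y1 - X) $ i $ j\<bar> \<le> (\<Sum>k\<in>UNIV. \<bar>W $ i $ k * D $ k $ j\<bar>)"
    by (simp add: sum_abs)
  also have "\<dots> \<le> (\<Sum>k\<in>UNIV. \<bar>W $ i $ k\<bar> * (?g * \<bar>Y1 $ k $ j\<bar>))"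
    using D(2) unfolding abs_matrix_le_iff
    by (intro sum_mono) (simp add: abs_mult mult_left_mono abs_vec_def)
  also have "\<dots> = (?g *\<^sub>R (\<bar>W\<bar> ** \<bar>Y1\<bar>)) $ i $ j"
    by (simp add: matrix_matrix_mult_def abs_vec_def sum_distrib_left mult_ac)
  finally show "\<bar>(W ** Y1 - X) $ i $ j\<bar> \<le> (?g *\<^sub>R (\<bar>W\<bar> ** \<bar>Y1\<bar>)) $ i $ j" .
qed

section \<open>The error analysis for one sketch matrix\<close>

text \<open>Deterministic core, for a sketch matrix that embeds the range of \<open>L\<close>. No
  term in \<open>1 / sqrt (1 - \<epsilon>)\<close> is subtracted in the lower bound: the factor
  \<open>e1\<close> in the bound on the solve residual cancels the \<open>1 / e1\<close> in the
  bound on \<open>w\<close>.\<close>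

lemma preconditioner_bounds:
  fixes \<Omega> :: "('s::finite, 'm::{finite,linorder}) rmat"
    and X L :: "('m, 'n::{finite,linorder}) rmat"
    and P :: "('m, 'm) rmat"
    and U :: "('n, 'n) rmat"
    and \<epsilon> c u ub :: real
  assumes n_le_s: "CARD('n) \<le> CARD('s)"
    and roundoff: "0 < ub" "ub \<le> u"
    and c_pos: "0 < c"
    and gamma: "gam (real CARD('n)) u \<le> 1.02 * real CARD('n) * u"
      "gam (real CARD('n)) ub \<le> 1.02 * real CARD('n) * ub"
      "gam (real CARD('m)) ub \<le> 1.02 * real CARD('m) * ub"
      "gam (c * real CARD('s) * real CARD('n)) ub
         \<le> 1.02 * (c * real CARD('s) * real CARD('n)) * ub"
    and eps: "0 \<le> \<epsilon>" "\<epsilon> < 1"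
    and embedding: "subspace_embedding \<epsilon> \<Omega> (range ((*v) L))"
    and lu: "computed_lu u X P L U"
    and size: "max c 1 * real CARD('s) * real CARD('n) * sqrt (real CARD('n)) * ub \<le> 1 / 64"
    and cond: "cond_restrictions \<epsilon> u ub c L U \<Omega>"
    and prec: "computed_preconditioner u ub c X L U \<Omega> Ls H Y0 Y1 W"
  shows "spectral_norm W \<le> 1.28 / sqrt (1 - \<epsilon>)"
    and "sing_val CARD('n) W \<ge> 4 / (5 * sqrt (1 + \<epsilon>))"
proof -

  \<comment> \<open>Notation and signs\<close>
  define n where "n = real CARD('n)"
  define s where "s = real CARD('s)"
  define t where "t = sketch_err ub CARD('n) \<Omega>"
  define d where "d = max (spectral_norm \<Omega>) 1"
  define e1 where "e1 = sqrt (1 - \<epsilon>)"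
  define e2 where "e2 = sqrt (1 + \<epsilon>)"
  define K where "K = e2 + t"
  define h where "h = c * s * n * sqrt n * ub"
  define l where "l = spectral_norm L"
  define l' where "l' = sing_val CARD('n) L"
  define m where "m = spectral_norm U"
  define m' where "m' = sing_val CARD('n) U"
  define w where "w = spectral_norm W"
  have n1: "1 \<le> n" by (simp add: n_def Suc_leI)
  have ns: "n \<le> s" using n_le_s by (simp add: n_def s_def)
  have sqrtn: "1 \<le> sqrt n" "sqrt n * sqrt n = n" using n1 by auto
  have u0: "0 < u" using roundoff by simp
  have e: "0 < e1" "e1 \<le> 1" "1 \<le> e2" using eps by (auto simp: e1_def e2_def)
  have t0: "0 \<le> t" using roundoff by (simp add: t_def sketch_err_def)
  have K: "1 \<le> K" "e2 \<le> K" using e t0 by (auto simp: K_def)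
  have h0: "0 < h" using c_pos n1 ns roundoff by (simp add: h_def)
  have l0: "0 \<le> l" "0 \<le> m" "0 \<le> w" by (simp_all add: l_def m_def w_def spectral_norm_nonneg)
  have d1: "1 \<le> d" by (simp add: d_def)
  have sv0: "0 < l'" "0 < m'"
    using cond unfolding cond_restrictions_def Let_def l'_def m'_def by blast+
  have Lst: "l' * norm v \<le> norm (L *v v)" "norm (L *v v) \<le> l * norm v" for v
    unfolding l_def l'_def by (rule last_sing_val_stretch, rule spectral_norm_bound)
  have Ust: "m' * norm v \<le> norm (U *v v)" for v
    unfolding m'_def by (rule last_sing_val_stretch)

  \<comment> \<open>Size and condition restrictions in product form\<close>
  have h64: "h \<le> 1 / 64"
  proof -
    have "h \<le> max c 1 * s * n * sqrt n * ub" unfolding h_def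
      using n1 ns roundoff by (intro mult_right_mono) auto
    then show ?thesis using size by (simp add: n_def s_def)
  qed
  \<comment> \<open>The bound holds even for small \<open>c\<close> because the size restriction has
    \<open>max c 1\<close>; the rest is \<open>n \<le> s\<close> and
    \<open>1 \<le> sqrt n\<close>.\<close>
  have nub: "n * n * ub \<le> 1 / 64"
  proof -
    have "n * n * ub \<le> (max c 1 * s) * (n * sqrt n) * ub"
      using n1 ns sqrtn roundoff mult_mono[of 1 "max c 1" n s] mult_left_mono[of 1 "sqrt n" n]
      by (intro mult_right_mono mult_mono) auto
    also have "\<dots> = max c 1 * s * n * sqrt n * ub" by (simp only: mult.assoc)
    finally show ?thesis using size unfolding n_def s_def by linarith
  qed

  note restrictions = cond[unfolded cond_restrictions_def Let_def cond2_def,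
      folded n_def s_def t_def d_def e1_def e2_def l_def l'_def m_def m'_def, folded K_def]
  have cL: "(25.5 * t + 25.5 * h * K) * l \<le> e1 * l'"
  proof -
    have "l / l' \<le> e1 / (25.5 * t + 25.5 * h * K)"
      using restrictions by (simp only: h_def mult.assoc)
    moreover have "0 < 25.5 * t + 25.5 * h * K" using t0 h0 K by (simp add: add_nonneg_pos)
    ultimately show ?thesis using sv0 by (simp add: field_simps)
  qed
  \<comment> \<open>The factor \<open>d \<ge> 1\<close> only strengthens the restriction and is
    dropped.\<close>
  have cLU: "23.6 * (n * n * v * K * l * m) \<le> e1 * (l' * m')" if "v \<in> {ub, u}" for v
  proof -
    have v0: "0 < v" using that roundoff by auto
    have "(l / l') * (m / m') \<le> e1 / (23.6 * d * n\<^sup>2 * v * K)"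
      using restrictions that by blast
    moreover have pos: "0 < 23.6 * d * n\<^sup>2 * v * K" using d1 n1 v0 K by simp
    ultimately have "(l * m) * (23.6 * d * n\<^sup>2 * v * K) \<le> e1 * (l' * m')"
      using sv0 by (simp add: field_simps)
    moreover have "(23.6 * n\<^sup>2 * v * K * l * m) * 1 \<le> (23.6 * n\<^sup>2 * v * K * l * m) * d"
      using d1 v0 K l0 by (intro mult_left_mono) auto
    ultimately show ?thesis by (simp add: power2_eq_square mult_ac)
  qed

  \<comment> \<open>Error matrices of the individual steps\<close>
  obtain Dlu where Dlu: "L ** U = P ** X + Dlu" "\<bar>Dlu\<bar> \<le> gam n u *\<^sub>R (\<bar>L\<bar> ** \<bar>U\<bar>)"
    and perm: "permutation_matrix P"
    using lu by (auto simp: computed_lu_def n_def)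
  obtain Ds where Ds: "Ls = \<Omega> ** L + Ds"
      "\<bar>Ds\<bar> \<le> gam (real CARD('m)) ub *\<^sub>R (\<bar>\<Omega>\<bar> ** \<bar>L\<bar>)"
    using prec by (auto simp: computed_preconditioner_def computed_sketch_def)
  obtain Dh where Dh: "H ** Y0 = Ls + Dh" "norm Dh \<le> gam (c * s * n) ub * norm Ls"
    and H: "norm (transpose H ** H - mat 1) \<le> 0.01"
    using prec by (auto simp: computed_preconditioner_def computed_qr_def n_def s_def)
  obtain Dy where Dy: "Y1 = Y0 ** U + Dy" "\<bar>Dy\<bar> \<le> gam n ub *\<^sub>R (\<bar>Y0\<bar> ** \<bar>U\<bar>)"
    using prec by (auto simp: computed_preconditioner_def computed_product_def n_def)
  define Dx where "Dx = W ** Y1 - X"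
  have Dx: "\<bar>Dx\<bar> \<le> gam n u *\<^sub>R (\<bar>W\<bar> ** \<bar>Y1\<bar>)"
    using prec computed_solve_residual by (auto simp: computed_preconditioner_def n_def Dx_def)

  text \<open>An entrywise error bounded by \<open>\<gamma>\<^sub>n\<close> times a product of matrices with \<open>n\<close> columns costs
    \<open>n\<^sup>2\<close> in the spectral norm: each factor contributes \<open>sqrt n\<close> through its Frobenius norm.\<close>
  have product_error: "norm (D *v z) \<le> 1.02 * (n * n * v * (spectral_norm A * spectral_norm B)) * norm z"
    if "\<bar>D\<bar> \<le> gam n v *\<^sub>R (\<bar>A\<bar> ** \<bar>B\<bar>)" "v \<in> {ub, u}"
    for D A :: "('k::finite, 'n) rmat" and B :: "('n, 'n) rmat" and v z
  proof -
    have v0: "0 < v" using that roundoff by auto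
    have "norm D \<le> (1.02 * n * v) * (norm A * norm B)"
      using that gamma v0 n1 by (intro componentwise_error_bound[OF that(1)]) (auto simp: n_def)
    also have "\<dots> \<le> (1.02 * n * v) * ((sqrt n * spectral_norm A) * (sqrt n * spectral_norm B))"
      using v0 n1 frobenius_norm_le_spectral[of A] frobenius_norm_le_spectral[of B]
      by (intro mult_left_mono mult_mono) (auto simp: n_def spectral_norm_nonneg)
    also have "\<dots> = 1.02 * ((sqrt n * sqrt n) * n * v * (spectral_norm A * spectral_norm B))"
      by (simp only: mult_ac)
    finally have "norm D \<le> 1.02 * (n * n * v * (spectral_norm A * spectral_norm B))"
      by (simp only: sqrtn)
    then show ?thesis
      using norm_matrix_vector_le[of D z] by (meson mult_right_mono norm_ge_zero order_trans)
  qed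

  \<comment> \<open>Sketching and QR: the size of \<open>Y0 v\<close>\<close>
  have Ds_le: "norm Ds \<le> t * l"
  proof -
    have "norm Ds \<le> (1.02 * real CARD('m) * ub) * (norm \<Omega> * norm L)"
      using gamma roundoff by (intro componentwise_error_bound[OF Ds(2)]) auto
    also have "\<dots> \<le> (1.02 * real CARD('m) * ub) * (norm \<Omega> * (sqrt n * l))"
      using roundoff frobenius_norm_le_spectral[of L]
      by (intro mult_left_mono) (auto simp: n_def l_def)
    also have "\<dots> = t * l" by (simp add: t_def sketch_err_def n_def mult_ac)
    finally show ?thesis .
  qed
  have \<Omega>L: "e1 * norm (L *v v) \<le> norm (\<Omega> *v (L *v v))" "norm (\<Omega> *v (L *v v)) \<le> e2 * norm (L *v v)" for v
    using subspace_embedding_stretch[OF embedding _ eps] by (auto simp: e1_def e2_def)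
  have Dsv: "norm (Ds *v v) \<le> t * l * norm v" for v
    using norm_matrix_vector_le[of Ds v] Ds_le by (meson mult_right_mono norm_ge_zero order_trans)
  have Lsv: "Ls *v v = \<Omega> *v (L *v v) + Ds *v v" for v
    by (simp add: Ds(1) matrix_vector_mult_add_rdistrib matrix_vector_mul_assoc)
  have Ls_le: "norm (Ls *v v) \<le> K * l * norm v" for v
  proof -
    have "norm (Ls *v v) \<le> e2 * norm (L *v v) + t * l * norm v"
      unfolding Lsv using \<Omega>L(2)[of v] Dsv[of v] norm_triangle_ineq by (smt (verit))
    also have "\<dots> \<le> e2 * (l * norm v) + t * l * norm v"
      using Lst(2)[of v] e by (intro add_right_mono mult_left_mono) auto
    finally show ?thesis by (simp add: K_def algebra_simps)
  qed
  then have "spectral_norm Ls \<le> K * l" by (rule onorm_le)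
  then have "sqrt n * spectral_norm Ls \<le> sqrt n * (K * l)" using n1 by (intro mult_left_mono) auto
  then have Ls_frob: "norm Ls \<le> sqrt n * (K * l)"
    using frobenius_norm_le_spectral[of Ls, folded n_def] by linarith
  have Dh_le: "norm Dh \<le> 1.02 * h * K * l"
  proof -
    have "norm Dh \<le> (1.02 * (c * s * n) * ub) * norm Ls"
      using Dh(2) mult_right_mono[OF gamma(4)[folded n_def s_def] norm_ge_zero[of Ls]] by linarith
    also have "\<dots> \<le> (1.02 * (c * s * n) * ub) * (sqrt n * (K * l))"
      using roundoff c_pos n1 ns Ls_frob by (intro mult_left_mono) auto
    finally show ?thesis by (simp add: h_def mult_ac)
  qed
  have Dhv: "norm (Dh *v v) \<le> 1.02 * h * K * l * norm v" for v
    using norm_matrix_vector_le[of Dh v] Dh_le by (meson mult_right_mono norm_ge_zero order_trans)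
  have HY: "H *v (Y0 *v v) = Ls *v v + Dh *v v" for v
    by (simp add: Dh(1) matrix_vector_mult_add_rdistrib matrix_vector_mul_assoc)

  \<comment> \<open>\<open>0.04 = 1.02 / 25.5\<close>; since \<open>t * l \<ge> 0\<close>, its
    coefficient \<open>1\<close> may be raised to \<open>1.02\<close>.\<close>
  have QR_error: "t * l + 1.02 * (h * K * l) \<le> 0.04 * (e1 * l')"
  proof -
    have "25.5 * (t * l) + 25.5 * (h * K * l) \<le> e1 * l'" using cL by (simp only: ring_distribs mult.assoc)
    moreover have "x + 1.02 * y \<le> 0.04 * z" if "25.5 * x + 25.5 * y \<le> z" "0 \<le> x" for x y z :: real
      using that by simp
    ultimately show ?thesis using mult_nonneg_nonneg[OF t0 l0(1)] by blast
  qed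
  have E: "norm (H *v (Y0 *v v) - \<Omega> *v (L *v v)) \<le> 0.04 * (e1 * norm (L *v v))" for v
  proof -
    have "norm (H *v (Y0 *v v) - \<Omega> *v (L *v v)) = norm (Ds *v v + Dh *v v)"
      by (simp add: HY Lsv)
    also have "\<dots> \<le> t * l * norm v + 1.02 * h * K * l * norm v"
      using Dsv[of v] Dhv[of v] by (rule norm_triangle_mono)
    also have "\<dots> = (t * l + 1.02 * (h * K * l)) * norm v" by (simp add: algebra_simps)
    also have "\<dots> \<le> (0.04 * (e1 * l')) * norm v"
      using QR_error by (rule mult_right_mono) simp
    also have "\<dots> = 0.04 * (e1 * (l' * norm v))" by simp
    also have "\<dots> \<le> 0.04 * (e1 * norm (L *v v))" using Lst(1)[of v] e by (intro mult_left_mono) auto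
    finally show ?thesis .
  qed
  note Hst = near_orthonormal_stretch[OF H]
  have HY_diff: "\<bar>norm (H *v (Y0 *v v)) - norm (\<Omega> *v (L *v v))\<bar> \<le> 0.04 * (e1 * norm (L *v v))" for v
    using norm_triangle_ineq3 E by (rule order_trans)
  \<comment> \<open>\<open>0.955 \<le> (1 - 0.04) / 1.005\<close>, and
    \<open>1.04 / 0.994 \<le> 1.047\<close> for the upper bound, where also
    \<open>e1 \<le> e2\<close>.\<close>
  have Y0_ge: "0.955 * (e1 * norm (L *v v)) \<le> norm (Y0 *v v)" for v
  proof -
    have "0.955 * a \<le> y" if "\<bar>b - o'\<bar> \<le> 0.04 * a" "a \<le> o'" "b \<le> 1.005 * y" "0 \<le> a" for a b o' y :: real
      using that unfolding abs_le_iff by simp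
    from this[OF HY_diff \<Omega>L(1) Hst(2)] show ?thesis using e by simp
  qed
  have Y0_le: "norm (Y0 *v v) \<le> 1.047 * (e2 * norm (L *v v))" for v
  proof -
    have "y \<le> 1.047 * a'" if "\<bar>b - o'\<bar> \<le> 0.04 * a" "o' \<le> a'" "0.994 * y \<le> b" "a \<le> a'" "0 \<le> a"
      for a a' b o' y :: real
      using that unfolding abs_le_iff by simp
    from this[OF HY_diff \<Omega>L(2) Hst(1)] show ?thesis using e by (simp add: mult_right_mono)
  qed
  \<comment> \<open>An operator bound, which \<open>product_error\<close> needs. Via
    \<open>h \<le> 1 / 64\<close> it is sharper than the \<open>1.047\<close> that
    \<open>Y0_le\<close> would give: \<open>1 + 1.02 / 64 \<le> 1.016\<close> and
    \<open>1.016 / 0.994 \<le> 1.023\<close>.\<close>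
  have "norm (Y0 *v v) \<le> 1.023 * (K * l) * norm v" for v
  proof -
    have "norm (H *v (Y0 *v v)) \<le> K * l * norm v + 1.02 * h * K * l * norm v"
      unfolding HY using Ls_le[of v] Dhv[of v] by (rule norm_triangle_mono)
    also have "\<dots> = (1 + 1.02 * h) * (K * l * norm v)" by (simp add: algebra_simps)
    also have "\<dots> \<le> 1.016 * (K * l * norm v)" using h64 K l0 by (intro mult_right_mono) auto
    finally have "0.994 * norm (Y0 *v v) \<le> 1.016 * (K * l * norm v)"
      using Hst(1)[of "Y0 *v v"] by (rule order_trans[rotated])
    moreover have "y \<le> 1.023 * a" if "0.994 * y \<le> 1.016 * a" "0 \<le> a" for a y :: real
      using that by simp
    moreover have "0 \<le> K * l * norm v" using K l0 by simp
    ultimately show ?thesis unfolding mult.assoc by blast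
  qed
  then have Y0_spec: "spectral_norm Y0 \<le> 1.023 * (K * l)" by (rule onorm_le)

  \<comment> \<open>The triangular product: the size of \<open>Y1 z\<close>\<close>
  have Y1v: "Y1 *v z = Y0 *v (U *v z) + Dy *v z" for z
    by (simp add: Dy(1) matrix_vector_mult_add_rdistrib matrix_vector_mul_assoc)
  have LU: "l' * m' * norm z \<le> norm (L *v (U *v z))" for z
  proof -
    have "l' * (m' * norm z) \<le> l' * norm (U *v z)" using Ust[of z] sv0 by (intro mult_left_mono) auto
    then show ?thesis using Lst(1)[of "U *v z"] by (simp add: mult.assoc)
  qed
  \<comment> \<open>Converts absolute errors into fractions of the reference
    \<open>norm (L U z)\<close>: \<open>cLU\<close> makes a coefficient \<open>a\<close> cost
    \<open>a / 23.6\<close>, and the factor \<open>e1\<close> is kept for later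
    cancellation.\<close>
  have scaled: "norm y \<le> b * (e1 * norm (L *v (U *v z)))"
    if "norm y \<le> a * (n * n * v * K * l * m) * norm z" "v \<in> {ub, u}" "0 \<le> a" "a \<le> 23.6 * b"
    for y :: "real^'k::finite" and a b v z
  proof -
    have "n * n * v * K * l * m * norm z \<le> e1 * (l' * m') / 23.6 * norm z"
      using cLU[OF that(2)] by (intro mult_right_mono) auto
    also have "\<dots> \<le> e1 * norm (L *v (U *v z)) / 23.6"
      using LU[of z] e mult_left_mono[of "l' * m' * norm z" "norm (L *v (U *v z))" e1]
      by (simp add: mult_ac)
    finally have "a * (n * n * v * K * l * m * norm z) \<le> a * (e1 * norm (L *v (U *v z)) / 23.6)"
      using that(3) by (rule mult_left_mono)
    also have "\<dots> = (a / 23.6) * (e1 * norm (L *v (U *v z)))" by simp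
    also have "\<dots> \<le> b * (e1 * norm (L *v (U *v z)))"
      using that(4) e by (intro mult_right_mono) auto
    finally show ?thesis using that(1) by (simp add: mult.assoc)
  qed
  \<comment> \<open>\<open>1.02 * 1.023 = 1.04346\<close>, rounded up; dividing by
    \<open>23.6\<close> gives the \<open>0.0443\<close> of \<open>Dy_small\<close>.\<close>
  have Dy_le: "norm (Dy *v z) \<le> 1.0435 * (n * n * ub * K * l * m) * norm z" for z
  proof -
    have "n * n * ub * (spectral_norm Y0 * m) \<le> n * n * ub * (1.023 * (K * l) * m)"
      using roundoff n1 l0 Y0_spec by (intro mult_left_mono mult_right_mono) auto
    then have "1.02 * (n * n * ub * (spectral_norm Y0 * m)) \<le> 1.04346 * (n * n * ub * K * l * m)"
      by (simp add: mult_ac)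
    also have "\<dots> \<le> 1.0435 * (n * n * ub * K * l * m)"
      using roundoff n1 l0 K by (intro mult_right_mono) auto
    finally have le: "1.02 * (n * n * ub * (spectral_norm Y0 * m)) \<le> 1.0435 * (n * n * ub * K * l * m)" .
    show ?thesis
      by (rule order_trans[OF product_error[OF Dy(2), folded m_def] mult_right_mono[OF le norm_ge_zero]]) simp
  qed
  have Dy_small: "norm (Dy *v z) \<le> 0.0443 * (e1 * norm (L *v (U *v z)))" for z
    by (rule scaled[OF Dy_le]) auto
  have Y1_ge: "0.9107 * (e1 * norm (L *v (U *v z))) \<le> norm (Y1 *v z)" for z
  proof -
    have "norm (Y0 *v (U *v z)) - norm (Dy *v z) \<le> norm (Y1 *v z)"
      using norm_diff_ineq[of "Y0 *v (U *v z)" "Dy *v z"] by (simp add: Y1v)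
    moreover have "0.9107 * a \<le> y" if "b - d \<le> y" "0.955 * a \<le> b" "d \<le> 0.0443 * a" for a b d y :: real
      using that by simp
    ultimately show ?thesis using Y0_ge Dy_small by blast
  qed
  have Y1_le: "norm (Y1 *v z) \<le> 1.0913 * (e2 * norm (L *v (U *v z)))" for z
  proof -
    have "norm (Y1 *v z) \<le> norm (Y0 *v (U *v z)) + norm (Dy *v z)"
      by (simp add: Y1v norm_triangle_ineq)
    moreover have "y \<le> 1.0913 * a'" if "y \<le> b + d" "b \<le> 1.047 * a'" "d \<le> 0.0443 * a" "a \<le> a'"
      for a a' b d y :: real
      using that by simp
    moreover have "e1 * norm (L *v (U *v z)) \<le> e2 * norm (L *v (U *v z))"
      using e by (intro mult_right_mono) auto
    ultimately show ?thesis using Y0_le Dy_small by blast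
  qed
  \<comment> \<open>Again an operator bound, here for the solve error:
    \<open>1.0435 / 64 \<le> 0.017\<close> by \<open>nub\<close>, and
    \<open>1.023 + 0.017 = 1.04\<close>.\<close>
  have "norm (Y1 *v z) \<le> 1.04 * (K * l * m) * norm z" for z
  proof -
    have "norm (Y0 *v (U *v z)) \<le> spectral_norm Y0 * norm (U *v z)" by (rule spectral_norm_bound)
    also have "\<dots> \<le> (1.023 * (K * l)) * (m * norm z)"
      using Y0_spec spectral_norm_bound[of U z] K l0 by (intro mult_mono) (auto simp: m_def)
    finally have Y0U: "norm (Y0 *v (U *v z)) \<le> 1.023 * (K * l * m * norm z)" by (simp add: mult.assoc)
    have "norm (Dy *v z) \<le> (1.0435 * (n * n * ub)) * (K * l * m * norm z)"
      using Dy_le[of z] by (simp add: mult_ac)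
    also have "\<dots> \<le> 0.017 * (K * l * m * norm z)"
      using nub K l0 by (intro mult_right_mono) auto
    finally have "norm (Y1 *v z) \<le> 1.023 * (K * l * m * norm z) + 0.017 * (K * l * m * norm z)"
      unfolding Y1v using Y0U by (intro norm_triangle_mono)
    then show ?thesis by simp
  qed
  then have Y1_spec: "spectral_norm Y1 \<le> 1.04 * (K * l * m)" by (rule onorm_le)

  \<comment> \<open>LU error and solve residual\<close>
  have Dlu_small: "norm (Dlu *v z) \<le> 0.0433 * norm (L *v (U *v z))" for z
  proof -
    \<comment> \<open>Inserting \<open>K \<ge> 1\<close> produces the shape required by
      \<open>scaled\<close>; then \<open>1.02 / 23.6 \<le> 0.0433\<close>.\<close>
    have "n * n * u * (l * m) * 1 \<le> n * n * u * (l * m) * K"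
      using K l0 u0 by (intro mult_left_mono) auto
    then have le: "1.02 * (n * n * u * (l * m)) \<le> 1.02 * (n * n * u * K * l * m)"
      by (simp add: mult_ac)
    have "norm (Dlu *v z) \<le> 1.02 * (n * n * u * K * l * m) * norm z"
      by (rule order_trans[OF product_error[OF Dlu(2), folded l_def m_def] mult_right_mono[OF le norm_ge_zero]]) simp
    then have "norm (Dlu *v z) \<le> 0.0433 * (e1 * norm (L *v (U *v z)))" by (rule scaled) auto
    then show ?thesis using mult_right_mono[of e1 1 "norm (L *v (U *v z))"] e by simp
  qed
  have Dx_small: "norm (Dx *v z) \<le> 0.045 * w * (e1 * norm (L *v (U *v z)))" for z
  proof (rule scaled)
    \<comment> \<open>\<open>1.02 * 1.04 = 1.0608\<close>, and
      \<open>1.0608 / 23.6 \<le> 0.045\<close>. The unknown \<open>w\<close> stays as a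
      factor.\<close>
    have "n * n * u * (w * spectral_norm Y1) \<le> n * n * u * (w * (1.04 * (K * l * m)))"
      using l0 u0 Y1_spec by (intro mult_left_mono) auto
    then have le: "1.02 * (n * n * u * (w * spectral_norm Y1)) \<le> 1.0608 * w * (n * n * u * K * l * m)"
      by (simp add: mult_ac)
    show "norm (Dx *v z) \<le> 1.0608 * w * (n * n * u * K * l * m) * norm z"
      by (rule order_trans[OF product_error[OF Dx, folded w_def] mult_right_mono[OF le norm_ge_zero]]) simp
  qed (use l0 in auto)
  \<comment> \<open>\<open>P\<close> preserves norms, so \<open>X z\<close> can be compared with
    \<open>L U z\<close> although only \<open>P X\<close> is factored.\<close>
  have X_diff: "\<bar>norm (X *v z) - norm (L *v (U *v z))\<bar> \<le> 0.0433 * norm (L *v (U *v z))" for z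
  proof -
    have "P *v (X *v z) - L *v (U *v z) = - (Dlu *v z)"
      using arg_cong[OF Dlu(1), of "\<lambda>A. A *v z"]
      by (simp add: matrix_vector_mult_add_rdistrib matrix_vector_mul_assoc)
    then show ?thesis
      using norm_triangle_ineq3[of "P *v (X *v z)" "L *v (U *v z)"] Dlu_small[of z]
      by (simp add: norm_permutation_matrix[OF perm])
  qed
  have WY: "W *v (Y1 *v z) = X *v z + Dx *v z" for z
    by (simp add: Dx_def matrix_vector_mult_diff_rdistrib matrix_vector_mul_assoc)

  \<comment> \<open>Invertibility of \<open>Y1\<close>\<close>
  have "inj ((*v) Y1)"
  proof (rule linear_injective_0[THEN iffD2, OF matrix_vector_mul_linear], intro allI impI)
    fix z assume "Y1 *v z = 0"
    then have "e1 * norm (L *v (U *v z)) \<le> 0" using Y1_ge[of z] by simp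
    then have "norm (L *v (U *v z)) \<le> 0" using e by (simp add: mult_le_0_iff)
    then show "z = 0" using LU[of z] sv0 by (simp add: mult_le_0_iff)
  qed
  \<comment> \<open>Every \<open>v\<close> is some \<open>Y1 z\<close>, so \<open>W v\<close> can be
    read off from \<open>X z\<close> plus the residual.\<close>
  then have surj: "surj ((*v) Y1)"
    by (intro linear_injective_imp_surjective) auto

  \<comment> \<open>Upper bound on the spectral norm\<close>
  have "norm (W *v v) \<le> (1.1457 / e1 + 0.0495 * w) * norm v" for v
  proof -
    obtain z where z: "v = Y1 *v z" using surj by blast
    define q where "q = e1 * norm (L *v (U *v z))"
    have q: "0 \<le> q" "0.9107 * q \<le> norm v" using Y1_ge[of z] e by (auto simp: q_def z)
    have "norm (W *v v) \<le> 1.0433 * norm (L *v (U *v z)) + 0.045 * w * q"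
    proof -
      have "norm (W *v v) \<le> norm (X *v z) + norm (Dx *v z)" by (simp add: z WY norm_triangle_ineq)
      moreover have "y \<le> 1.0433 * a + d'" if "y \<le> x + d" "\<bar>x - a\<bar> \<le> 0.0433 * a" "d \<le> d'"
        for a d d' x y :: real
        using that unfolding abs_le_iff by simp
      ultimately show ?thesis using X_diff Dx_small unfolding q_def by blast
    qed
    also have "\<dots> = (1.0433 / e1 + 0.045 * w) * q" using e by (simp add: q_def field_simps)
    also have "\<dots> \<le> (1.0433 / e1 + 0.045 * w) * (norm v / 0.9107)"
      using q e l0 by (intro mult_left_mono) auto
    also have "\<dots> = ((1.0433 / 0.9107) / e1 + (0.045 / 0.9107) * w) * norm v" by (simp add: field_simps)
    also have "\<dots> \<le> (1.1457 / e1 + 0.0495 * w) * norm v"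
      using e l0 by (intro mult_right_mono add_mono divide_right_mono) auto
    finally show ?thesis .
  qed
  \<comment> \<open>The self-referential inequality is solved for \<open>w\<close>:
    \<open>1.1457 / (1 - 0.0495) \<le> 1.206\<close>.\<close>
  then have "w \<le> 1.1457 / e1 + 0.0495 * w" unfolding w_def by (rule onorm_le)
  then have w_le: "w \<le> 1.206 / e1" using e by (simp add: field_simps)
  also have "\<dots> \<le> 1.28 / e1" using e by (intro divide_right_mono) auto
  finally show "spectral_norm W \<le> 1.28 / sqrt (1 - \<epsilon>)" by (simp add: w_def e1_def)

  \<comment> \<open>Lower bound on the last singular value\<close>
  have "0.8 / e2 * norm v \<le> norm (W *v v)" for v
  proof -
    obtain z where z: "v = Y1 *v z" using surj by blast
    define q where "q = norm (L *v (U *v z))"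
    have q: "0 \<le> q" "norm v \<le> 1.0913 * (e2 * q)" using Y1_le[of z] by (auto simp: q_def z)
    have "w * e1 * q \<le> 1.206 * q"
      using w_le e q by (intro mult_right_mono) (auto simp: field_simps)
    \<comment> \<open>\<open>1 - 0.0433 - 0.045 * 1.206 \<ge> 0.9\<close>; below,
      \<open>0.8 * 1.0913 \<le> 0.9\<close> leaves room for passing from \<open>q\<close> to
      \<open>norm v\<close>.\<close>
    then have "0.9 * q \<le> norm (W *v v)"
    proof -
      have "norm (X *v z) - norm (Dx *v z) \<le> norm (W *v v)"
        using norm_diff_ineq[of "X *v z" "Dx *v z"] by (simp add: z WY)
      moreover have "norm (Dx *v z) \<le> 0.045 * (w * e1 * q)"
        using Dx_small[of z] by (simp only: q_def mult.assoc)
      moreover have "0.9 * q \<le> y"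
        if "x - d \<le> y" "\<bar>x - q\<bar> \<le> 0.0433 * q" "d \<le> 0.045 * b" "b \<le> 1.206 * q" for b d x y :: real
        using that q(1) unfolding abs_le_iff by simp
      moreover note \<open>w * e1 * q \<le> 1.206 * q\<close>
      ultimately show ?thesis using X_diff unfolding q_def by blast
    qed
    moreover have "0.8 / e2 * norm v \<le> 0.8 / e2 * (1.0913 * (e2 * q))"
      using q e by (intro mult_left_mono) auto
    moreover have "\<dots> \<le> 0.9 * q" using q e by simp
    ultimately show ?thesis by linarith
  qed
  then have "0.8 / e2 \<le> sing_val CARD('n) W" by (rule last_sing_val_ge)
  then show "sing_val CARD('n) W \<ge> 4 / (5 * sqrt (1 + \<epsilon>))" by (simp add: e2_def)
qed

section \<open>From one sketch matrix to probability\<close>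

theorem theorem3p3:
  fixes M :: "'w measure"
    and \<Omega> :: "'w \<Rightarrow> ('s::finite, 'm::{finite,linorder}) rmat"
    and X L :: "('m, 'n::{finite,linorder}) rmat"
    and P :: "('m, 'm) rmat"
    and U :: "('n, 'n) rmat"
    and \<epsilon> p c u ub :: real
  assumes dims: "CARD('n) < CARD('m)" "CARD('n) \<le> CARD('s)" "CARD('s) \<le> CARD('m)"
    and full_rank: "rank X = CARD('n)"
    and roundoff: "0 < ub" "ub \<le> u"
    and c_pos: "0 < c"
    and gamma: "gam (real CARD('n)) u \<le> 1.02 * real CARD('n) * u"
      "gam (real CARD('n)) ub \<le> 1.02 * real CARD('n) * ub"
      "gam (real CARD('m)) ub \<le> 1.02 * real CARD('m) * ub"
      "gam (c * real CARD('s) * real CARD('n)) ub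
         \<le> 1.02 * (c * real CARD('s) * real CARD('n)) * ub"
    and prob: "prob_space M" "\<Omega> \<in> borel_measurable M"
    and eps: "0 \<le> \<epsilon>" "\<epsilon> < 1" and p: "0 \<le> p" "p \<le> 1"
    and embedding: "oblivious_subspace_embedding M \<Omega> \<epsilon> p CARD('n)"
    and eta: "eta (real CARD('m)) (real CARD('n)) u < 1"
      "\<epsilon> < (1 - (eta (real CARD('m)) (real CARD('n)) u)\<^sup>2)
            / (1 + (eta (real CARD('m)) (real CARD('n)) u)\<^sup>2)"
    and lu: "computed_lu u X P L U"
    and size: "real CARD('m) * sqrt (real CARD('s)) * ub \<le> 1 / 64"
      "max c 1 * real CARD('s) * real CARD('n) * sqrt (real CARD('n)) * ub \<le> 1 / 64"
  shows "with_prob_ge M ((1 - p)\<^sup>2) (\<lambda>\<omega>.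
           \<forall>Ls H Y0 Y1 W.
             cond_restrictions \<epsilon> u ub c L U (\<Omega> \<omega>) \<longrightarrow>
             computed_preconditioner u ub c X L U (\<Omega> \<omega>) Ls H Y0 Y1 W \<longrightarrow>
             spectral_norm W \<le> 1.28 / sqrt (1 - \<epsilon>) \<and>
             sing_val CARD('n) W \<ge> 4 / (5 * sqrt (1 + \<epsilon>)) - 0.08 / sqrt (1 - \<epsilon>))"
proof -
  interpret prob_space M by (rule prob)
  let ?goal = "\<lambda>\<omega>. \<forall>Ls H Y0 Y1 W.
             cond_restrictions \<epsilon> u ub c L U (\<Omega> \<omega>) \<longrightarrow>
             computed_preconditioner u ub c X L U (\<Omega> \<omega>) Ls H Y0 Y1 W \<longrightarrow>
             spectral_norm W \<le> 1.28 / sqrt (1 - \<epsilon>) \<and>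
             sing_val CARD('n) W \<ge> 4 / (5 * sqrt (1 + \<epsilon>)) - 0.08 / sqrt (1 - \<epsilon>)"
  have sq: "(1 - p)\<^sup>2 \<le> 1 - p"
    using p by (simp add: power2_eq_square mult_left_le)
  show ?thesis
  \<comment> \<open>\<open>L\<close> does not depend on \<open>\<omega>\<close>, so this is a
    deterministic distinction. In the positive case the range of \<open>L\<close> is a fixed
    subspace of the dimension that the oblivious embedding asks for.\<close>
  proof (cases "0 < sing_val CARD('n) L")
    case True
    have "inj ((*v) L)"
    proof (rule linear_injective_0[THEN iffD2, OF matrix_vector_mul_linear], intro allI impI)
      fix z assume "L *v z = 0"
      then show "z = 0" using True last_sing_val_stretch[of L z] by (simp add: mult_le_0_iff)
    qed
    then have "dim (range ((*v) L)) = CARD('n)"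
      by (subst dim_image_eq[OF matrix_vector_mul_linear]) auto
    moreover have "subspace (range ((*v) L))"
      by (intro linear_subspace_image matrix_vector_mul_linear subspace_UNIV)
    ultimately have "with_prob_ge M (1 - p) (\<lambda>\<omega>. subspace_embedding \<epsilon> (\<Omega> \<omega>) (range ((*v) L)))"
      using embedding by (simp add: oblivious_subspace_embedding_def)
    then obtain E where E: "E \<in> sets M" "1 - p \<le> measure M E"
      "\<And>\<omega>. \<omega> \<in> E \<Longrightarrow> subspace_embedding \<epsilon> (\<Omega> \<omega>) (range ((*v) L))"
      by (auto simp: with_prob_ge_def)
    have pos: "0 \<le> 0.08 / sqrt (1 - \<epsilon>)" using eps by simp
    \<comment> \<open>The event \<open>E\<close> is chosen before the computed matrices, so it
      serves all of them at once; \<open>pos\<close> weakens the lower bound to the stated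
      form.\<close>
    have "?goal \<omega>" if "\<omega> \<in> E" for \<omega>
      using preconditioner_bounds[OF dims(2) roundoff c_pos gamma eps E(3)[OF that] lu size(2)] pos
      by (smt (verit, best))
    then show ?thesis unfolding with_prob_ge_def using E sq by (intro bexI[of _ E]) auto
  next
    case False
    \<comment> \<open>The claim is vacuous for every realization, so the whole space serves as the
      event.\<close>
    then have "\<not> cond_restrictions \<epsilon> u ub c L U (\<Omega> \<omega>)" for \<omega>
      by (simp add: cond_restrictions_def Let_def)
    then show ?thesis
      unfolding with_prob_ge_def using sq p by (intro bexI[of _ "space M"]) (auto simp: prob_space)
  qed
qed

end
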